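(* Let $a,b,c,l$ be positive integers, let $n=a+b+c$, and suppose that $n/\gcd(a,b,c)=2^l$. Then the following hold. (a) The state $(a,b,c)$ is pourable, and there is a sequence of pouring steps starting from $(a,b,c)$ such that after exactly $l$ steps two of the vessels are empty. (b) The state $(a,b,c)$ is pourable in at most $\lfloor\log n\rfloor$ steps.
   Context: A state with three vessels is a vector of three non-negative integers (the contents of the vessels). A pouring step chooses two distinct vessels with contents $x$ and $y$, where $x\le y$, and replaces these contents by $2x$ (for the vessel that contained $x$) and $y-x$ (for the vessel that contained $y$); the third content is unchanged. A vessel is empty if its content is $0$. A state is pourable if some finite sequence of pouring steps leads to a state with at least one empty vessel, and it is pourable in at most $t$ steps if some sequence of at most $t$ pouring steps does so. $\log$ denotes $\log_2$. *)

theory Defs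
  imports "HOL-Analysis.Analysis"
begin

type_synonym state = "nat ^ 3"

text \<open>The vessel \<open>i\<close> is doubled from the vessel \<open>j\<close>. The natural-number
  subtraction is exact because of the guard \<open>s $ i \<le> s $ j\<close>. A pour into an
  empty vessel \<open>i\<close> is allowed and leaves the state unchanged.\<close>

definition pouring_step :: "state \<Rightarrow> state \<Rightarrow> bool" where
  "pouring_step s s' \<longleftrightarrow>
     (\<exists>i j. i \<noteq> j \<and> s $ i \<le> s $ j \<and>
        s' = (\<chi> k. if k = i then 2 * s $ i else if k = j then s $ j - s $ i else s $ k))"

definition empty_vessels :: "state \<Rightarrow> 3 set" where
  "empty_vessels s = {i. s $ i = 0}"

definition pourable :: "state \<Rightarrow> bool" where
  "pourable s \<longleftrightarrow> (\<exists>s'. pouring_step\<^sup>*\<^sup>* s s' \<and> empty_vessels s' \<noteq> {})"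

definition pourable_within :: "nat \<Rightarrow> state \<Rightarrow> bool" where
  "pourable_within t s \<longleftrightarrow>
     (\<exists>k\<le>t. \<exists>s'. (pouring_step ^^ k) s s' \<and> empty_vessels s' \<noteq> {})"

end

theory Submission
  imports Defs
begin

text \<open>Divide the contents by their greatest common divisor. The quotients have sum \<open>2 ^ l\<close>
  and are not all even, so for \<open>l > 0\<close> exactly two of them are odd. Pouring between these two
  makes all quotients even, and halving them leaves a triple with sum \<open>2 ^ (l - 1)\<close>. This
  triple contains the smaller of the two odd numbers, so it is again not all even. After \<open>l\<close>
  steps the sum of the quotients is 1.\<close>

text \<open>An even sum has an even number of odd terms, so among three entries one odd entry forces
  exactly one more. The two odd entries can be named so that \<open>t $ i \<le> t $ j\<close>, which
  makes the pour from \<open>j\<close> into \<open>i\<close> legal.\<close>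

lemma two_odd_entries:
  fixes t :: state
  assumes "even (\<Sum>k\<in>UNIV. t $ k)" and "odd (t $ m)"
  obtains i j where "i \<noteq> j" "odd (t $ i)" "odd (t $ j)" "t $ i \<le> t $ j"
    "\<And>k. k \<noteq> i \<Longrightarrow> k \<noteq> j \<Longrightarrow> even (t $ k)"
proof -
  have ev: "even (t $ 1 + t $ 2 + t $ 3)"
    using assms(1) by (simp add: sum_3)
  consider "odd (t $ 1)" "odd (t $ 2)" "even (t $ 3)" | "odd (t $ 1)" "even (t $ 2)" "odd (t $ 3)"
    | "even (t $ 1)" "odd (t $ 2)" "odd (t $ 3)"
    using ev assms(2) exhaust_3[of m] by auto
  then obtain i j where "i \<noteq> j" "odd (t $ i)" "odd (t $ j)"
    "\<forall>k. k \<noteq> i \<longrightarrow> k \<noteq> j \<longrightarrow> even (t $ k)"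
    by cases (rule that[of 1 2] that[of 1 3] that[of 2 3]; simp add: forall_3)+
  then show thesis
    using that[of i j] that[of j i] by (metis nat_le_linear)
qed

text \<open>The scale \<open>g\<close> is separated from the quotients \<open>t\<close> for the sake
  of the induction: the contents themselves are never divided, but each pour doubles
  \<open>g\<close> while the sum of \<open>t\<close> halves.\<close>

lemma pour_scaled_to_two_empty:
  fixes s t :: state
  assumes "g > 0" and "\<And>k. s $ k = g * t $ k"
    and "(\<Sum>k\<in>UNIV. t $ k) = 2 ^ l" and "odd (t $ m)"
  shows "\<exists>s'. (pouring_step ^^ l) s s' \<and> card (empty_vessels s') = 2"
  using assms
proof (induction l arbitrary: g s t m)
  case 0
  have "t $ 1 + t $ 2 + t $ 3 = 1"
    using 0 by (simp add: sum_3)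
  then consider "t $ 1 = 1" "t $ 2 = 0" "t $ 3 = 0" | "t $ 1 = 0" "t $ 2 = 1" "t $ 3 = 0"
    | "t $ 1 = 0" "t $ 2 = 0" "t $ 3 = 1"
    by linarith
  then obtain i j where "i \<noteq> j" "{k. t $ k = 0} = {i, j}"
    by cases (rule that[of 2 3] that[of 1 3] that[of 1 2];
        simp add: set_eq_iff forall_3)+
  moreover have "empty_vessels s = {k. t $ k = 0}"
    using 0 by (simp add: empty_vessels_def)
  ultimately have "card (empty_vessels s) = 2"
    by simp
  then show ?case
    by auto
next
  case (Suc l)
  have "even (\<Sum>k\<in>UNIV. t $ k)"
    using Suc.prems(3) by simp
  then obtain i j where ij: "i \<noteq> j" "odd (t $ i)" "odd (t $ j)" "t $ i \<le> t $ j"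
    and ev: "\<And>k. k \<noteq> i \<Longrightarrow> k \<noteq> j \<Longrightarrow> even (t $ k)"
    using two_odd_entries Suc.prems(4) by blast
  define s' :: state where
    "s' = (\<chi> k. if k = i then 2 * s $ i else if k = j then s $ j - s $ i else s $ k)"
  \<comment> \<open>These are the quotients after the pour with respect to the new scale
    \<open>2 * g\<close>. Both uses of \<open>div\<close> are exact: a difference of two odd numbers
    is even, and the third entry is even.\<close>
  define t' :: state where
    "t' = (\<chi> k. if k = i then t $ i else if k = j then (t $ j - t $ i) div 2 else t $ k div 2)"
  have t'2: "2 * t' $ k = (if k = i then 2 * t $ i else if k = j then t $ j - t $ i else t $ k)" for k
    using ij ev by (simp add: t'_def)
  have "s' $ k = (2 * g) * t' $ k" for k
  proof -
    have "s' $ k = g * (2 * t' $ k)"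
      unfolding t'2 by (simp add: s'_def Suc.prems(2) diff_mult_distrib2)
    then show ?thesis by simp
  qed
  moreover have "(\<Sum>k\<in>UNIV. t' $ k) = 2 ^ l"
  proof -
    \<comment> \<open>The pour preserves the total, since \<open>t $ i \<le> t $ j\<close> makes the
      subtraction of natural numbers exact.\<close>
    have "2 * (\<Sum>k\<in>UNIV. t' $ k) = (\<Sum>k\<in>UNIV. t $ k)"
      unfolding sum_distrib_left t'2
      using ij(1,4) exhaust_3[of i] exhaust_3[of j] by (auto simp: sum_3)
    then show ?thesis
      using Suc.prems(3) by simp
  qed
  \<comment> \<open>Doubling by the pour and halving by the new scale cancel at \<open>i\<close>, so
    this entry keeps its odd value.\<close>
  moreover have "odd (t' $ i)"
    using ij by (simp add: t'_def)
  ultimately obtain s'' where "(pouring_step ^^ l) s' s''" "card (empty_vessels s'') = 2"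
    using Suc.IH[of "2 * g" s' t' i] Suc.prems(1) by auto
  moreover have "pouring_step s s'"
    unfolding pouring_step_def s'_def using ij Suc.prems(2) by (metis mult_le_mono2)
  ultimately show ?case
    by (meson relpowp_Suc_I2)
qed

theorem theorem20:
  fixes a b c l n :: nat
  assumes "a > 0" and "b > 0" and "c > 0" and "l > 0"
    and "n = a + b + c"
    and "real n / real (Gcd {a, b, c}) = 2 ^ l"
  shows "(pourable (vector [a, b, c]) \<and>
          (\<exists>s. (pouring_step ^^ l) (vector [a, b, c]) s \<and> card (empty_vessels s) = 2)) \<and>
         pourable_within (nat \<lfloor>log 2 (real n)\<rfloor>) (vector [a, b, c])"
proof -
  define g where "g = Gcd {a, b, c}"
  have g: "g > 0"
    using assms(1) by (simp add: g_def)
  have "real n = real (g * 2 ^ l)"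
    using assms(6) g unfolding g_def[symmetric] by (simp add: field_simps)
  then have n: "n = g * 2 ^ l"
    by (simp only: of_nat_eq_iff)
  have dvd: "g dvd a" "g dvd b" "g dvd c"
    unfolding g_def by (rule Gcd_dvd; simp)+
  define t :: state where "t = vector [a div g, b div g, c div g]"
  have "\<exists>m. odd (t $ m)"
  \<comment> \<open>If all quotients were even, \<open>g * 2\<close> would be a common divisor of
    \<open>a\<close>, \<open>b\<close>, \<open>c\<close> and hence divide their gcd
    \<open>g\<close>.\<close>
  proof (rule ccontr)
    assume "\<nexists>m. odd (t $ m)"
    then have "2 dvd a div g" "2 dvd b div g" "2 dvd c div g"
      by (simp_all add: t_def forall_3)
    then have "g * 2 dvd a" "g * 2 dvd b" "g * 2 dvd c"
      using dvd g by (simp_all add: dvd_div_iff_mult mult.commute)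
    then have "g * 2 dvd g"
      by (simp add: g_def)
    then show False
      using g by simp
  qed
  then obtain m where "odd (t $ m)" ..
  moreover have "\<forall>k. (vector [a, b, c] :: state) $ k = g * t $ k"
    using dvd by (simp add: t_def forall_3)
  moreover have "(\<Sum>k\<in>UNIV. t $ k) = 2 ^ l"
  proof -
    have "g * (\<Sum>k\<in>UNIV. t $ k) = g * 2 ^ l"
      using dvd n assms(5) by (simp add: t_def sum_3 distrib_left)
    then show ?thesis
      using g by simp
  qed
  ultimately obtain s where s: "(pouring_step ^^ l) (vector [a, b, c]) s"
      "card (empty_vessels s) = 2"
    using pour_scaled_to_two_empty[OF g] by blast
  then have empty: "empty_vessels s \<noteq> {}"
    by auto
  \<comment> \<open>The same \<open>l\<close> pours serve for the bound in (b), because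
    \<open>n = g * 2 ^ l\<close> with \<open>g \<ge> 1\<close>.\<close>
  have "2 ^ l \<le> real n"
    using n g by simp
  then have "real l \<le> log 2 (real n)"
    using le_log_of_power by simp
  then have "l \<le> nat \<lfloor>log 2 (real n)\<rfloor>"
    by (simp add: le_nat_iff le_floor_iff)
  then show ?thesis
    using s empty unfolding pourable_def pourable_within_def
    by (metis relpowp_imp_rtranclp)
qed

end
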